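(* Let $k$ be a positive integer and $n=2k$. Then $rn(C_n\square C_n)\le \frac{n^2-2}{2}(k+2)+2$.
   Context: $C_n$ is the cycle graph with vertex set $\{0,\dots,n-1\}$, distinct $v,w$ adjacent iff $v\equiv w\pm1 \pmod n$. The Cartesian product $G\square H$ has vertex set $V(G)\times V(H)$, with $(g,h)\sim(g',h')$ iff ($g=g'$ and $hh'\in E(H)$) or ($h=h'$ and $gg'\in E(G)$). $d(u,v)$ is graph distance and $\operatorname{diam}(G)$ the maximum distance in $G$. A radio labeling of a connected graph $G$ is a function $c:V(G)\to\{1,2,\dots\}$ with $d(u,v)+|c(u)-c(v)|\ge 1+\operatorname{diam}(G)$ for all distinct $u,v$. The span of $c$ is its maximum value; $rn(G)$ is the minimum span over all radio labelings of $G$. *)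

theory Defs
  imports "Graph_Theory.Pair_Digraph" "HOL-Number_Theory.Cong" Complex_Main
begin

text \<open>
  A finite simple graph is a \<^locale>\<open>pair_graph\<close>: a finite, loop-free, symmetric digraph
  without parallel arcs, in which an edge \<open>uv\<close> is represented by the two arcs \<open>(u, v)\<close> and
  \<open>(v, u)\<close>.
\<close>

definition cycle_graph :: "nat \<Rightarrow> nat pair_pre_digraph" where
  "cycle_graph n = \<lparr> pverts = {0..<n},
     parcs = {(v, w). v \<in> {0..<n} \<and> w \<in> {0..<n} \<and> v \<noteq> w \<and>
       ([int v = int w + 1] (mod int n) \<or> [int v = int w - 1] (mod int n))} \<rparr>"

definition cartesian_product ::
    "'a pair_pre_digraph \<Rightarrow> 'b pair_pre_digraph \<Rightarrow> ('a \<times> 'b) pair_pre_digraph" where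
  "cartesian_product G H = \<lparr> pverts = pverts G \<times> pverts H,
     parcs = {((g, h), (g', h')). (g, h) \<in> pverts G \<times> pverts H \<and>
       (g', h') \<in> pverts G \<times> pverts H \<and>
       (g = g' \<and> (h, h') \<in> parcs H \<or> h = h' \<and> (g, g') \<in> parcs G)} \<rparr>"

text \<open>
  The distance is the minimum number of edges of a walk; it is only meaningful for vertices
  joined by some walk. Likewise the diameter, span and radio number below are meant for
  finite, nonempty, connected graphs, for which all minima and maxima are attained.
\<close>

definition graph_dist :: "'a pair_pre_digraph \<Rightarrow> 'a \<Rightarrow> 'a \<Rightarrow> nat" where
  "graph_dist G u v = (LEAST l. \<exists>p. pre_digraph.awalk (with_proj G) u p v \<and> length p = l)"

definition graph_diam :: "'a pair_pre_digraph \<Rightarrow> nat" where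
  "graph_diam G = Max {graph_dist G u v | u v. u \<in> pverts G \<and> v \<in> pverts G}"

definition radio_labeling :: "'a pair_pre_digraph \<Rightarrow> ('a \<Rightarrow> nat) \<Rightarrow> bool" where
  "radio_labeling G c \<longleftrightarrow> (\<forall>v\<in>pverts G. 1 \<le> c v) \<and>
     (\<forall>u\<in>pverts G. \<forall>v\<in>pverts G. u \<noteq> v \<longrightarrow>
        int (graph_dist G u v) + \<bar>int (c u) - int (c v)\<bar> \<ge> 1 + int (graph_diam G))"

definition label_span :: "'a pair_pre_digraph \<Rightarrow> ('a \<Rightarrow> nat) \<Rightarrow> nat" where
  "label_span G c = Max (c ` pverts G)"

definition radio_number :: "'a pair_pre_digraph \<Rightarrow> nat" where
  "radio_number G = (LEAST s. \<exists>c. radio_labeling G c \<and> label_span G c = s)"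

lemma pair_graph_cycle_graph: "pair_graph (cycle_graph n)"
proof
  show "finite (parcs (cycle_graph n))"
    by (rule finite_subset[of _ "{0..<n} \<times> {0..<n}"]) (auto simp: cycle_graph_def)
  have *: "[int v = int w + 1] (mod int n) \<longleftrightarrow> [int w = int v - 1] (mod int n)" for v w
    by (auto simp: cong_iff_dvd_diff dvd_diff_commute algebra_simps)
  show "symmetric (with_proj (cycle_graph n))"
    unfolding symmetric_def by (auto intro!: symI simp: cycle_graph_def * cong_sym_eq)
qed (auto simp: cycle_graph_def)

lemma pair_graph_cartesian_product:
  assumes "pair_graph G" "pair_graph H"
  shows "pair_graph (cartesian_product G H)"
proof -
  interpret G: pair_graph G by fact
  interpret H: pair_graph H by fact
  show ?thesis
  proof
    show "finite (pverts (cartesian_product G H))"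
      by (simp add: cartesian_product_def)
    show "finite (parcs (cartesian_product G H))"
      by (rule finite_subset[of _ "(pverts G \<times> pverts H) \<times> (pverts G \<times> pverts H)"])
        (auto simp: cartesian_product_def)
    show "symmetric (with_proj (cartesian_product G H))"
      unfolding symmetric_def
      by (auto intro!: symI simp: cartesian_product_def
          intro: G.arcs_symmetric H.arcs_symmetric)
    show "fst e \<noteq> snd e" if "e \<in> parcs (cartesian_product G H)" for e
      using that by (auto simp: cartesian_product_def dest: G.no_loops H.no_loops)
  qed (auto simp: cartesian_product_def)
qed

end

theory Submission
  imports Defs
begin

text \<open>
  Writing \<open>A\<close> for the antipodal map \<open>p \<mapsto> p + (k, k)\<close>, the distances satisfy
  \<open>d(p, A q) = 2 k - d(p, q)\<close>. If \<open>p\<^sub>0, p\<^sub>1, \<dots>\<close> lists one vertex from each of the \<open>2 k\<^sup>2\<close>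
  antipodal pairs so that consecutive vertices have distance \<open>k - 1\<close> or \<open>k\<close>, then labelling
  \<open>p\<^sub>t\<close> with \<open>1 + t (k + 2)\<close> and \<open>A p\<^sub>t\<close> with \<open>2 + t (k + 2)\<close> is a radio labeling: the
  conditions for positions that differ by at least two hold trivially. Such a list is
  \<open>p\<^sub>t = (s i + j, i)\<close> for \<open>t = i + k j\<close>, \<open>i < k\<close>, \<open>j < 2 k\<close>, where \<open>s = k - 1\<close> for even
  \<open>k\<close> and \<open>s = k - 2\<close> for odd \<open>k\<close>.
\<close>

section \<open>Graph distance from a potential function\<close>

text \<open>By \<open>lip\<close>, a walk from \<open>u\<close> to \<open>v\<close> needs at least
  \<open>f u\<close> arcs; following \<open>desc\<close>, \<open>f\<close> drops by one at each arc,
  which gives a walk of exactly that length.\<close>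

lemma graph_dist_eqI:
  fixes f :: "'a \<Rightarrow> nat"
  assumes "pair_wf_digraph G" and u: "u \<in> pverts G" and v: "v \<in> pverts G"
    and fv: "f v = 0"
    and lip: "\<And>a b. (a, b) \<in> parcs G \<Longrightarrow> f a \<le> Suc (f b)"
    and desc: "\<And>a. a \<in> pverts G \<Longrightarrow> a \<noteq> v \<Longrightarrow> \<exists>b. (a, b) \<in> parcs G \<and> f a = Suc (f b)"
  shows "graph_dist G u v = f u"
proof -
  interpret pair_wf_digraph G by fact
  have lower: "f a \<le> length p" if "awalk a p v" for a p
    using that
  proof (induction p arbitrary: a)
    case Nil
    then show ?case by (simp add: awalk_def fv)
  next
    case (Cons e p)
    then obtain b where "e = (a, b)" "(a, b) \<in> parcs G" "awalk b p v"
      by (cases e) (auto simp: awalk_Cons_iff)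
    with Cons.IH[of b] lip[of a b] show ?case by simp
  qed
  have upper: "\<exists>p. awalk a p v \<and> length p = f a" if "a \<in> pverts G" for a
    using that
  proof (induction "f a" arbitrary: a)
    case 0
    then have "a = v" using desc[of a] by auto
    then have "awalk a [] v" using v by (simp add: awalk_def)
    with 0 show ?case by (metis list.size(3))
  next
    case (Suc m)
    then have "a \<noteq> v" using fv by auto
    then obtain b where b: "(a, b) \<in> parcs G" "f a = Suc (f b)"
      using desc Suc.prems by blast
    then have "b \<in> pverts G" using in_arcsD2 by auto
    then obtain p where "awalk b p v" "length p = f b"
      using Suc.hyps b by fastforce
    then have "awalk a ((a, b) # p) v \<and> length ((a, b) # p) = f a"
      using b by (simp add: awalk_Cons_iff)
    then show ?case by blast
  qed
  show ?thesis
    unfolding graph_dist_def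
    by (rule Least_equality) (use upper[OF u] lower in auto)
qed

section \<open>Distances in the cycle\<close>

lemma pverts_cycle_graph: "pverts (cycle_graph n) = {0..<n}"
  by (simp add: cycle_graph_def)

lemma parcs_cycle_graph:
  "(v, w) \<in> parcs (cycle_graph n) \<longleftrightarrow> v < n \<and> w < n \<and> v \<noteq> w \<and>
     (v = Suc w \<or> w = Suc v \<or> v = 0 \<and> Suc w = n \<or> w = 0 \<and> Suc v = n)"
proof -
  have "[int v = int w + 1] (mod int n) \<longleftrightarrow> v = Suc w \<or> v = 0 \<and> Suc w = n"
    if "v < n" "w < n" for v w
  proof -
    have "[int v = int w + 1] (mod int n) \<longleftrightarrow> v mod n = Suc w mod n"
      unfolding cong_def by (metis of_nat_Suc of_nat_eq_iff zmod_int add.commute)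
    with that show ?thesis by (auto simp: mod_Suc)
  qed
  moreover have "[int v = int w - 1] (mod int n) \<longleftrightarrow> [int w = int v + 1] (mod int n)"
    by (auto simp: cong_iff_dvd_diff dvd_diff_commute algebra_simps)
  ultimately show ?thesis
    by (auto simp: cycle_graph_def)
qed

text \<open>For arguments below \<open>n\<close>, this is the length of the shorter of the two arcs
  between them.\<close>

definition cycle_dist :: "nat \<Rightarrow> nat \<Rightarrow> nat \<Rightarrow> nat" where
  "cycle_dist n x y = nat (min \<bar>int x - int y\<bar> (int n - \<bar>int x - int y\<bar>))"

lemma cycle_dist_arc:
  assumes "(a, b) \<in> parcs (cycle_graph n)" "y < n"
  shows "cycle_dist n a y \<le> Suc (cycle_dist n b y)"
  using assms unfolding parcs_cycle_graph cycle_dist_def by auto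

lemma cycle_dist_descent:
  assumes "a < n" "y < n" "a \<noteq> y"
  shows "\<exists>b. (a, b) \<in> parcs (cycle_graph n) \<and> cycle_dist n a y = Suc (cycle_dist n b y)"
proof -
  \<comment> \<open>The witness is the next vertex on a shortest arc towards \<open>y\<close>; in
    \<open>over\<close> and \<open>under\<close> that arc crosses the edge between
    \<open>n - 1\<close> and \<open>0\<close>.\<close>
  consider (down) "y < a" "2 * (a - y) \<le> n" | (up) "a < y" "2 * (y - a) \<le> n"
    | (over) "y < a" "2 * (a - y) > n" | (under) "a < y" "2 * (y - a) > n"
    using assms by linarith
  then show ?thesis
  proof cases
    case down
    then show ?thesis using assms
      by (intro exI[of _ "a - 1"]) (auto simp: parcs_cycle_graph cycle_dist_def)
  next
    case up
    then show ?thesis using assms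
      by (intro exI[of _ "a + 1"]) (auto simp: parcs_cycle_graph cycle_dist_def)
  next
    case over
    then show ?thesis using assms
      by (intro exI[of _ "if Suc a = n then 0 else Suc a"])
        (auto simp: parcs_cycle_graph cycle_dist_def)
  next
    case under
    then show ?thesis using assms
      by (intro exI[of _ "if a = 0 then n - 1 else a - 1"])
        (auto simp: parcs_cycle_graph cycle_dist_def)
  qed
qed

text \<open>Distances can be read off any residue \<open>r\<close> in the range from
  \<open>0\<close> to \<open>n\<close>: the true difference is then \<open>r\<close> or
  \<open>r - n\<close>.\<close>

lemma cycle_dist_cong:
  assumes "x < n" "x' < n" "[int x' - int x = r] (mod int n)" "0 \<le> r" "r \<le> int n"
  shows "int (cycle_dist n x x') = min r (int n - r)"
proof -
  obtain q where q: "int x' - int x = r + int n * q"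
    using assms(3) by (metis cong_iff_lin cong_sym mult.commute)
  have n: "0 < int n" using assms(1) by linarith
  have "int n * q < int n * 1" using q assms by linarith
  then have "q < 1" using n by (simp only: mult_less_cancel_left_pos)
  moreover have "int n * (-2) < int n * q" using q assms by linarith
  then have "-2 < q" using n by (simp only: mult_less_cancel_left_pos)
  ultimately consider "q = 0" | "q = -1" by linarith
  then show ?thesis
    by cases (use q assms in \<open>auto simp: cycle_dist_def\<close>)
qed

section \<open>Distance and diameter of the torus\<close>

definition torus :: "nat \<Rightarrow> (nat \<times> nat) pair_pre_digraph" where
  "torus n = cartesian_product (cycle_graph n) (cycle_graph n)"

lemma pverts_torus: "pverts (torus n) = {0..<n} \<times> {0..<n}"
  by (simp add: torus_def cartesian_product_def pverts_cycle_graph)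

lemma parcs_torus:
  "((x, y), (x', y')) \<in> parcs (torus n) \<longleftrightarrow>
     (x = x' \<and> x < n \<and> (y, y') \<in> parcs (cycle_graph n)) \<or>
     (y = y' \<and> y < n \<and> (x, x') \<in> parcs (cycle_graph n))"
  by (auto simp: torus_def cartesian_product_def pverts_cycle_graph parcs_cycle_graph)

text \<open>An arc moves one coordinate only, so the sum of cycle distances is a valid potential: it
  can be lowered in any coordinate that still differs from its target.\<close>

lemma graph_dist_torus:
  assumes "x < n" "y < n" "x' < n" "y' < n"
  shows "graph_dist (torus n) (x, y) (x', y') = cycle_dist n x x' + cycle_dist n y y'"
proof -
  interpret pair_graph "torus n"
    unfolding torus_def by (intro pair_graph_cartesian_product pair_graph_cycle_graph)
  define f where "f = (\<lambda>(a, b). cycle_dist n a x' + cycle_dist n b y')"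
  have "graph_dist (torus n) (x, y) (x', y') = f (x, y)"
  proof (rule graph_dist_eqI)
    show "pair_wf_digraph (torus n)" ..
    show "f (x', y') = 0" by (simp add: f_def cycle_dist_def)
    show "f a \<le> Suc (f b)" if "(a, b) \<in> parcs (torus n)" for a b
    proof -
      obtain a1 a2 b1 b2 where ab: "a = (a1, a2)" "b = (b1, b2)" by (cases a, cases b)
      show ?thesis
        using that[unfolded ab parcs_torus] assms
          cycle_dist_arc[of a1 b1 n x'] cycle_dist_arc[of a2 b2 n y']
        by (auto simp: ab f_def)
    qed
    show "\<exists>b. (a, b) \<in> parcs (torus n) \<and> f a = Suc (f b)"
      if "a \<in> pverts (torus n)" "a \<noteq> (x', y')" for a
    proof -
      obtain a1 a2 where a: "a = (a1, a2)" "a1 < n" "a2 < n"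
        using \<open>a \<in> pverts (torus n)\<close> by (auto simp: pverts_torus)
      show ?thesis
      proof (cases "a1 = x'")
        case True
        then obtain b where "(a2, b) \<in> parcs (cycle_graph n)"
          "cycle_dist n a2 y' = Suc (cycle_dist n b y')"
          using cycle_dist_descent[of a2 n y'] a \<open>a \<noteq> (x', y')\<close> assms True by blast
        then show ?thesis
          by (intro exI[of _ "(a1, b)"]) (use a in \<open>simp add: f_def parcs_torus\<close>)
      next
        case False
        then obtain b where "(a1, b) \<in> parcs (cycle_graph n)"
          "cycle_dist n a1 x' = Suc (cycle_dist n b x')"
          using cycle_dist_descent[of a1 n x'] a assms by blast
        then show ?thesis
          by (intro exI[of _ "(b, a2)"]) (use a in \<open>simp add: f_def parcs_torus\<close>)
      qed
    qed
  qed (use assms in \<open>auto simp: pverts_torus\<close>)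
  then show ?thesis by (simp add: f_def)
qed

text \<open>A larger diameter only strengthens the radio condition, so an upper bound is the useful
  direction.\<close>

lemma graph_diam_torus_le:
  assumes "k > 0"
  shows "graph_diam (torus (2 * k)) \<le> 2 * k"
proof -
  let ?n = "2 * k"
  let ?D = "{graph_dist (torus ?n) u v | u v. u \<in> pverts (torus ?n) \<and> v \<in> pverts (torus ?n)}"
  have le: "d \<le> 2 * k" if "d \<in> ?D" for d
  proof -
    have "cycle_dist ?n x y \<le> k" for x y
      by (auto simp: cycle_dist_def)
    with that show ?thesis
      by (auto simp: pverts_torus graph_dist_torus add_mono mult_2)
  qed
  have "finite ?D" using le by (meson atMost_iff finite_atMost finite_subset subsetI)
  moreover have "(0, 0) \<in> pverts (torus ?n)" using assms by (simp add: pverts_torus)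
  then have "?D \<noteq> {}" by blast
  ultimately show ?thesis
    unfolding graph_diam_def by (rule Max.boundedI) (rule le)
qed

lemma cycle_dist_commute: "cycle_dist n x y = cycle_dist n y x"
  by (simp add: cycle_dist_def abs_minus_commute)

section \<open>Positions and labels\<close>

text \<open>The multiplier \<open>s\<close>: close to \<open>k\<close>, with the parity split chosen
  so that \<open>1 - s * (k - 1)\<close> is \<open>0\<close> or \<open>-1\<close> modulo
  \<open>2 * k\<close>.\<close>

definition slope :: "nat \<Rightarrow> int" where
  "slope k = (if even k then int k - 1 else int k - 2)"

text \<open>Inverts the list: with \<open>i = y mod k\<close> and \<open>b = y div k\<close>, this
  is the \<open>j\<close> solving \<open>x = s * i + j + k * b\<close> modulo \<open>2 * k\<close>.
  On the torus \<open>b\<close> is a bit that tells a listed vertex from an antipode.\<close>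

definition column :: "nat \<Rightarrow> nat \<times> nat \<Rightarrow> nat" where
  "column k v = nat ((int (fst v) - int k * int (snd v div k) - slope k * int (snd v mod k))
      mod (2 * int k))"

definition torus_pos :: "nat \<Rightarrow> nat \<times> nat \<Rightarrow> nat" where
  "torus_pos k v = snd v mod k + k * column k v"

definition torus_label :: "nat \<Rightarrow> nat \<times> nat \<Rightarrow> nat" where
  "torus_label k v = 1 + snd v div k + torus_pos k v * (k + 2)"

lemma column_less: "k > 0 \<Longrightarrow> column k v < 2 * k"
  unfolding column_def by (simp add: nat_less_iff)

lemma column_cong:
  assumes "k > 0"
  shows "[int x = int (column k (x, y)) + slope k * int (y mod k) + int k * int (y div k)]
    (mod int (2 * k))"
proof -
  let ?z = "int x - int k * int (y div k) - slope k * int (y mod k)"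
  have "int (column k (x, y)) = ?z mod int (2 * k)"
    using assms by (simp add: column_def)
  then have "[?z = int (column k (x, y))] (mod int (2 * k))"
    by (simp add: cong_def)
  from cong_add[OF this cong_refl[of "slope k * int (y mod k) + int k * int (y div k)"]]
  show ?thesis by (simp add: algebra_simps)
qed

lemma torus_pos_less:
  assumes "k > 0"
  shows "torus_pos k v < 2 * k * k"
proof -
  have "torus_pos k v < k + k * column k v"
    using assms by (simp add: torus_pos_def)
  also have "\<dots> = k * Suc (column k v)" by simp
  also have "\<dots> \<le> k * (2 * k)"
    using column_less[OF assms, of v] by (intro mult_le_mono2) simp
  finally show ?thesis by (simp add: mult_ac)
qed

lemma torus_pos_eqD:
  assumes "k > 0" "torus_pos k (x, y) = torus_pos k (x', y')"
  shows "y mod k = y' mod k" "column k (x, y) = column k (x', y')"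
proof -
  show "y mod k = y' mod k"
    using arg_cong[OF assms(2), of "\<lambda>t. t mod k"] by (simp add: torus_pos_def)
  show "column k (x, y) = column k (x', y')"
    using arg_cong[OF assms(2), of "\<lambda>t. t div k"] assms(1) by (simp add: torus_pos_def)
qed

text \<open>A position has last digit \<open>y mod k\<close> in base \<open>k\<close>, so its
  successor either raises that digit or carries into the column.\<close>

lemma torus_pos_SucD:
  assumes "k > 0" "torus_pos k (x', y') = Suc (torus_pos k (x, y))"
  shows "y' mod k = Suc (y mod k) \<and> column k (x', y') = column k (x, y) \<or>
    y' mod k = 0 \<and> Suc (y mod k) = k \<and> column k (x', y') = Suc (column k (x, y))"
proof -
  have m: "torus_pos k (x, y) mod k = y mod k" "torus_pos k (x, y) div k = column k (x, y)"
    for x y using assms(1) by (simp_all add: torus_pos_def)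
  have "torus_pos k (x', y') mod k = Suc (torus_pos k (x, y)) mod k"
    "torus_pos k (x', y') div k = Suc (torus_pos k (x, y)) div k"
    by (simp_all add: assms(2))
  then show ?thesis
    unfolding mod_Suc div_Suc m by (auto split: if_splits simp: mod_Suc m)
qed

text \<open>The move of the first coordinate at a carry, apart from any antipodal shift:
  \<open>i\<close> falls from \<open>k - 1\<close> to \<open>0\<close> while \<open>j\<close> grows
  by one. It equals \<open>k * (2 - k)\<close> for even \<open>k\<close> and
  \<open>k * (3 - k) - 1\<close> for odd \<open>k\<close>.\<close>

lemma step_wrap_cong:
  assumes "k > 0"
  shows "[1 - slope k * (int k - 1) = (if even k then 0 else 2 * int k - 1)] (mod int (2 * k))"
proof (cases "even k")
  case True
  then obtain m where "k = 2 * m" by blast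
  then have "1 - slope k * (int k - 1) - 0 = int (2 * k) * (1 - int m)"
    using True by (simp add: slope_def algebra_simps)
  then show ?thesis using True by (simp add: cong_iff_dvd_diff)
next
  case False
  then obtain m where "k = 2 * m + 1" by (rule oddE)
  then have "1 - slope k * (int k - 1) - (2 * int k - 1) = int (2 * k) * (- int m)"
    using False by (simp add: slope_def algebra_simps)
  then show ?thesis using False by (simp add: cong_iff_dvd_diff)
qed

section \<open>The radio condition\<close>

text \<open>Labels at consecutive positions differ by \<open>k + 2\<close> plus the change of
  \<open>y div k\<close>; the bound is what remains of \<open>2 * k + 1\<close>.\<close>

lemma torus_step_dist:
  fixes x y x' y' k :: nat
  defines "n \<equiv> 2 * k"
  assumes k: "k > 0" and lt: "x < n" "y < n" "x' < n" "y' < n"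
    and Suc: "torus_pos k (x', y') = Suc (torus_pos k (x, y))"
  shows "int (cycle_dist n x x' + cycle_dist n y y') + int (y' div k) - int (y div k) \<ge> int k - 1"
proof -
  define \<delta> where "\<delta> = int (y' div k) - int (y div k)"
  have "y div k < 2" "y' div k < 2"
    using lt k by (simp_all add: n_def less_mult_imp_div_less)
  then have \<delta>: "\<delta> = 0 \<or> \<delta> = 1 \<or> \<delta> = -1" by (auto simp: \<delta>_def)
  have ydiff: "int y' - int y = int (y' mod k) - int (y mod k) + int k * \<delta>"
    by (simp add: \<delta>_def algebra_simps flip: of_nat_mult of_nat_add)
  have xdiff: "[int x' - int x = int (column k (x', y')) - int (column k (x, y))
      + slope k * (int (y' mod k) - int (y mod k)) + int k * \<delta>] (mod int n)"
    using cong_diff[OF column_cong[OF k, of x' y'] column_cong[OF k, of x y]]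
    by (simp add: n_def \<delta>_def algebra_simps)
  \<comment> \<open>modulo \<open>2 * k\<close>, both signs of \<open>\<delta>\<close> give the same shift by \<open>k\<close>\<close>
  have shift: "[r + int k * \<delta> = r + int k * \<bar>\<delta>\<bar>] (mod int n)"
    "[r + int k * \<delta> = r - int k * \<bar>\<delta>\<bar>] (mod int n)" for r
    using \<delta> by (auto simp: cong_iff_dvd_diff n_def)
  have ydist: "int (cycle_dist n y y') = min \<bar>int y' - int y\<bar> (int n - \<bar>int y' - int y\<bar>)"
    using lt by (auto simp: cycle_dist_def)
  from torus_pos_SucD[OF k Suc] show ?thesis
  proof (elim disjE conjE)
    assume *: "y' mod k = Suc (y mod k)" "column k (x', y') = column k (x, y)"
    \<comment> \<open>A raised digit needs two residues, which excludes \<open>k = 1\<close>, where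
      the slope would be \<open>-1\<close>.\<close>
    have "k \<ge> 2" using *(1) mod_less_divisor[OF k, of y'] by linarith
    then have s: "slope k = int k - 1 \<or> slope k = int k - 2" "slope k \<ge> 0" by (auto simp: slope_def)
    have "[int x' - int x = slope k + int k * \<bar>\<delta>\<bar>] (mod int n)"
      using cong_trans[OF _ shift(1)[of "slope k"]] xdiff * by simp
    then have "int (cycle_dist n x x') = min (slope k + int k * \<bar>\<delta>\<bar>) (int n - (slope k + int k * \<bar>\<delta>\<bar>))"
      using \<delta> s lt by (intro cycle_dist_cong) (auto simp: n_def)
    moreover have "int y' - int y = 1 + int k * \<delta>"
      using ydiff * by simp
    ultimately show ?thesis
      using ydist \<delta> s \<open>k \<ge> 2\<close> \<delta>_def by (auto simp: n_def)
  next
    assume *: "y' mod k = 0" "Suc (y mod k) = k" "column k (x', y') = Suc (column k (x, y))"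
    then have ym: "int (y mod k) = int k - 1" by linarith
    have yd: "int y' - int y = 1 - int k + int k * \<delta>" using ydiff * ym by simp
    define r where "r = (if even k then 0 else 2 * int k - 1)"
    have "[int x' - int x = 1 - slope k * (int k - 1) + int k * \<delta>] (mod int n)"
      using xdiff * ym by (simp add: algebra_simps)
    moreover have "[1 - slope k * (int k - 1) + int k * \<delta> = r + int k * \<delta>] (mod int n)"
      unfolding r_def n_def by (intro cong_add step_wrap_cong k cong_refl)
    ultimately have xr: "[int x' - int x = r + int k * \<delta>] (mod int n)"
      by (rule cong_trans)
    \<comment> \<open>The shift by \<open>k\<close> goes up from \<open>0\<close> but down from
      \<open>2 * k - 1\<close>, which keeps \<open>r'\<close> between \<open>0\<close> and
      \<open>n\<close>.\<close>
    define r' where "r' = (if even k then int k * \<bar>\<delta>\<bar> else 2 * int k - 1 - int k * \<bar>\<delta>\<bar>)"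
    have "[int x' - int x = r'] (mod int n)"
      using cong_trans[OF xr] shift[of r] by (auto simp: r'_def r_def)
    then have "int (cycle_dist n x x') = min r' (int n - r')"
      using \<delta> lt k by (intro cycle_dist_cong) (auto simp: n_def r'_def)
    then show ?thesis
      using ydist yd \<delta> k \<delta>_def by (auto simp: n_def r'_def split: if_splits)
  qed
qed

text \<open>Equal positions mean antipodes, at distance \<open>2 * k\<close> with labels differing
  by one; consecutive positions fall under \<open>torus_step_dist\<close>; beyond that the labels
  alone suffice.\<close>

lemma torus_label_radio_le:
  fixes x y x' y' k :: nat
  defines "n \<equiv> 2 * k"
  assumes k: "k > 0" and lt: "x < n" "y < n" "x' < n" "y' < n" and ne: "(x, y) \<noteq> (x', y')"
    and le: "torus_pos k (x, y) \<le> torus_pos k (x', y')"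
  shows "int (cycle_dist n x x' + cycle_dist n y y')
    + \<bar>int (torus_label k (x, y)) - int (torus_label k (x', y'))\<bar> \<ge> 1 + 2 * int k"
proof -
  let ?t = "torus_pos k (x, y)" and ?t' = "torus_pos k (x', y')"
  have b: "y div k < 2" "y' div k < 2"
    using lt k by (simp_all add: n_def less_mult_imp_div_less)
  have diff: "int (torus_label k (x', y')) - int (torus_label k (x, y))
      = int (y' div k) - int (y div k) + (int ?t' - int ?t) * (int k + 2)"
    by (simp add: torus_label_def algebra_simps)
  consider "?t' = ?t" | "?t' = Suc ?t" | "?t' \<ge> ?t + 2" using le by linarith
  then show ?thesis
  proof cases
    case 1
    note eq = torus_pos_eqD[OF k 1]
    have y: "y = y mod k + k * (y div k)" "y' = y mod k + k * (y' div k)"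
      using eq by (simp, metis mod_mult_div_eq)
    have xd: "[int x' - int x = int k * (int (y' div k) - int (y div k))] (mod int n)"
      using cong_diff[OF column_cong[OF k, of x' y'] column_cong[OF k, of x y]] eq
      by (simp add: n_def algebra_simps)
    \<comment> \<open>Position and half together determine the vertex.\<close>
    have "y div k \<noteq> y' div k"
    proof
      assume div: "y div k = y' div k"
      with xd have "[int x' - int x = 0] (mod int n)" by simp
      then have "int (cycle_dist n x x') = min 0 (int n - 0)"
        using lt by (intro cycle_dist_cong) auto
      then have "x = x'" using lt by (auto simp: cycle_dist_def split: if_splits)
      moreover have "y = y'" using y div by simp
      ultimately show False using ne by simp
    qed
    then have b': "y div k = 0 \<and> y' div k = 1 \<or> y div k = 1 \<and> y' div k = 0" using b by linarith
    then have "[int k * (int (y' div k) - int (y div k)) = int k] (mod int n)"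
      by (auto simp: cong_iff_dvd_diff n_def)
    with xd have "[int x' - int x = int k] (mod int n)" by (rule cong_trans)
    then have "int (cycle_dist n x x') = min (int k) (int n - int k)"
      using lt by (intro cycle_dist_cong) (auto simp: n_def)
    moreover have "y' = y + k \<or> y = y' + k"
      using b' y by (metis add_0_right mult_0_right nat_mult_1_right)
    then have "cycle_dist n y y' = k" by (auto simp: cycle_dist_def n_def)
    ultimately show ?thesis using diff 1 b' by (auto simp: n_def)
  next
    case 2
    then show ?thesis
      using torus_step_dist[OF k, of x y x' y'] lt diff unfolding n_def by auto
  next
    case 3
    \<comment> \<open>Two steps contribute \<open>2 * k + 4\<close>, and the halves take back at
      most \<open>1\<close>.\<close>
    then have "2 * (int k + 2) \<le> (int ?t' - int ?t) * (int k + 2)"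
      by (intro mult_right_mono) auto
    moreover have "int (y' div k) - int (y div k) \<ge> -1" using b by linarith
    ultimately have "1 + 2 * int k \<le> int (torus_label k (x', y')) - int (torus_label k (x, y))"
      unfolding diff by simp
    then show ?thesis by linarith
  qed
qed

lemma radio_labeling_torus:
  assumes k: "k > 0"
  shows "radio_labeling (torus (2 * k)) (torus_label k)"
  unfolding radio_labeling_def
proof (intro conjI ballI impI)
  fix u v assume uv: "u \<in> pverts (torus (2 * k))" "v \<in> pverts (torus (2 * k))" "u \<noteq> v"
  obtain x y x' y' where u: "u = (x, y)" and v: "v = (x', y')" by (cases u, cases v)
  have lt: "x < 2 * k" "y < 2 * k" "x' < 2 * k" "y' < 2 * k"
    using uv by (auto simp: u v pverts_torus)
  have "1 + 2 * int k \<le> int (graph_dist (torus (2 * k)) u v)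
      + \<bar>int (torus_label k u) - int (torus_label k v)\<bar>"
  proof (cases "torus_pos k u \<le> torus_pos k v")
    case True
    then show ?thesis
      using torus_label_radio_le[OF k, of x y x' y'] lt uv by (simp add: u v graph_dist_torus)
  next
    case False
    then show ?thesis
      using torus_label_radio_le[OF k, of x' y' x y] lt uv
      by (auto simp: u v graph_dist_torus cycle_dist_commute abs_minus_commute)
  qed
  with graph_diam_torus_le[OF k]
  show "1 + int (graph_diam (torus (2 * k))) \<le> int (graph_dist (torus (2 * k)) u v)
      + \<bar>int (torus_label k u) - int (torus_label k v)\<bar>"
    by linarith
qed (simp add: torus_label_def)

section \<open>The span and the final bound\<close>

text \<open>The last of the \<open>2 * k * k\<close> positions is \<open>2 * k * k - 1\<close>, and
  an antipode there has offset \<open>2\<close>.\<close>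

lemma label_span_torus_le:
  assumes k: "k > 0"
  shows "label_span (torus (2 * k)) (torus_label k) \<le> (2 * k * k - 1) * (k + 2) + 2"
proof -
  have "torus_label k v \<le> (2 * k * k - 1) * (k + 2) + 2" if "v \<in> pverts (torus (2 * k))" for v
  proof -
    have "snd v div k < 2" using that by (auto simp: pverts_torus less_mult_imp_div_less)
    moreover have "torus_pos k v * (k + 2) \<le> (2 * k * k - 1) * (k + 2)"
      using torus_pos_less[OF k, of v] by (intro mult_le_mono1) linarith
    ultimately show ?thesis unfolding torus_label_def by linarith
  qed
  moreover have "(0, 0) \<in> pverts (torus (2 * k))" using k by (simp add: pverts_torus)
  then have "pverts (torus (2 * k)) \<noteq> {}" by blast
  ultimately show ?thesis
    unfolding label_span_def by (subst Max_le_iff) (auto simp: pverts_torus)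
qed

theorem theorem3p3:
  fixes k n :: nat
  assumes "k > 0" and "n = 2 * k"
  shows "real (radio_number (cartesian_product (cycle_graph n) (cycle_graph n)))
    \<le> ((real n)\<^sup>2 - 2) / 2 * (real k + 2) + 2"
proof -
  have "radio_number (torus n) \<le> label_span (torus n) (torus_label k)"
    unfolding radio_number_def using radio_labeling_torus[OF assms(1)] assms(2)
    by (intro Least_le) auto
  also have "\<dots> \<le> (2 * k * k - 1) * (k + 2) + 2"
    using label_span_torus_le[OF assms(1)] assms(2) by simp
  finally have "real (radio_number (torus n)) \<le> real ((2 * k * k - 1) * (k + 2) + 2)"
    by (rule of_nat_mono)
  also have "\<dots> = ((real n)\<^sup>2 - 2) / 2 * (real k + 2) + 2"
  proof -
    \<comment> \<open>Positivity of \<open>k\<close> keeps the natural subtraction from truncating;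
      the value is \<open>(n^2 - 2) / 2\<close>.\<close>
    have "real (2 * k * k - 1) = 2 * real k * real k - 1"
      using assms(1) by (simp add: of_nat_diff Suc_le_eq)
    then show ?thesis
      unfolding assms(2) of_nat_add of_nat_mult[of _ "k + 2"]
      by (simp only:) (simp add: power2_eq_square field_simps)
  qed
  finally show ?thesis by (simp add: torus_def)
qed

end
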